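(* Let $\mathcal{G}$ be a directed acyclic graph (DAG) with vertex set $\{T,Y,U\}$ (no observed confounder). Let $K\ge 1$ environments be given, with $N_k\ge 2$ observations in environment $k$. Suppose the data are generated by the hierarchical multi-environment model with shared causal graph $\mathcal{G}$ and non-degenerate, pairwise independent random causal mechanisms $\Theta_T^{(k)},\Theta_Y^{(k)},\Theta_U^{(k)}$ (as defined in the context), and that the resulting joint distribution $P$ satisfies the causal Markov property and faithfulness with respect to the augmented DAG $\mathcal{G}^*$ (as defined in the context). Then, for any $k\in\{1,\dots,K\}$, there is hidden confounding between $T$ and $Y$ in $\mathcal{G}$ (i.e. both edges $U\to T$ and $U\to Y$ are in $\mathcal{G}$) if and only if, for all $i,j\in\{1,\dots,N_k\}$ with $i\neq j$, both of the following conditional dependencies hold: $$\text{(i)}\quad T_j^{(k)}\not\perp\!\!\!\perp_P Y_i^{(k)}\mid T_i^{(k)}\qquad\text{and}\qquad \text{(ii)}\quad T_j^{(k)}\not\perp\!\!\!\perp_P Y_i^{(k)}\mid Y_j^{(k)} .$$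
   Context: Variables: $T$ (treatment) and $Y$ (outcome) are one-dimensional; $U$ (unobserved covariates) may have arbitrary dimension and is treated as a single vertex. $\mathrm{Pa}(V)$ denotes the set of parents of $V$ in the DAG under consideration. Hierarchical multi-environment model. All environments $k=1,\dots,K$ share the same causal DAG $\mathcal{G}$ on $\{T,Y,U\}$. For each $V\in\{T,Y,U\}$ the causal mechanism (the conditional distribution of $V$ given its parents in $\mathcal{G}$) is parametrized by a random variable $\Theta_V$ with a non-degenerate distribution $P(\Theta_V)$, and $\Theta_T,\Theta_Y,\Theta_U$ are pairwise independent. For each environment $k$ one draws, i.i.d. over $k$, mechanisms $\Theta_V^{(k)}\sim P(\Theta_V)$, $V\in\{T,Y,U\}$; then, conditionally on these mechanisms, the observations $(T_i^{(k)},Y_i^{(k)},U_i^{(k)})$, $i=1,\dots,N_k$, are drawn i.i.d. from the distribution with causal factorization $$\prod_{V\in\{T,Y,U\}}P_{\Theta_V^{(k)}}(V\mid \mathrm{Pa}(V)).$$ The numbers $N_k$ are fixed. $P$ denotes the resulting joint distribution of the mechanisms and all observations; conditional independence statements about observations are with respect to $P$ and do not condition on the mechanisms or on the environment. Augmented DAG $\mathcal{G}^*$: its vertices are $\Theta_V^{(k)}$ and $V_i^{(k)}$ for $V\in\{T,Y,U\}$, $k=1,\dots,K$, $i=1,\dots,N_k$. For each $(i,k)$ the edges among $T_i^{(k)},Y_i^{(k)},U_i^{(k)}$ are the same as those among $T,Y,U$ in $\mathcal{G}$; in addition there is an edge $\Theta_V^{(k)}\to V_i^{(k)}$ for all $V,i,k$;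 there are no other edges. Causal Markov property and faithfulness with respect to $\mathcal{G}^*$: for all disjoint sets $\mathbf{A},\mathbf{B},\mathbf{C}$ of vertices of $\mathcal{G}^*$, $\mathbf{A}$ and $\mathbf{B}$ are conditionally independent given $\mathbf{C}$ under $P$ if $\mathbf{A}$ and $\mathbf{B}$ are d-separated by $\mathbf{C}$ in $\mathcal{G}^*$ (causal Markov property), and only if they are (faithfulness). $\perp\!\!\!\perp_P$ denotes (conditional) independence under $P$. *)

theory Defs
  imports "HOL-Probability.Probability"
begin

section \<open>d-separation\<close>

definition undirected_path :: "'v rel \<Rightarrow> 'v list \<Rightarrow> bool" where
  "undirected_path E p \<longleftrightarrow> p \<noteq> [] \<and> distinct p \<and>
     (\<forall>i. Suc i < length p \<longrightarrow> (p ! i, p ! Suc i) \<in> E \<or> (p ! Suc i, p ! i) \<in> E)"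

definition collider_at :: "'v rel \<Rightarrow> 'v list \<Rightarrow> nat \<Rightarrow> bool" where
  "collider_at E p i \<longleftrightarrow> (p ! (i - 1), p ! i) \<in> E \<and> (p ! Suc i, p ! i) \<in> E"

text \<open>A collider is a descendant of itself here, since \<open>E\<^sup>*\<close> is reflexive.\<close>

definition blocked :: "'v rel \<Rightarrow> 'v set \<Rightarrow> 'v list \<Rightarrow> bool" where
  "blocked E C p \<longleftrightarrow> (\<exists>i. 0 < i \<and> Suc i < length p \<and>
     (if collider_at E p i then E\<^sup>* `` {p ! i} \<inter> C = {} else p ! i \<in> C))"

definition d_separated :: "'v rel \<Rightarrow> 'v set \<Rightarrow> 'v set \<Rightarrow> 'v set \<Rightarrow> bool" where
  "d_separated E A B C \<longleftrightarrow>
     (\<forall>p. undirected_path E p \<and> hd p \<in> A \<and> last p \<in> B \<longrightarrow> blocked E C p)"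

definition pairwise_disjoint :: "'v set \<Rightarrow> 'v set \<Rightarrow> 'v set \<Rightarrow> bool" where
  "pairwise_disjoint A B C \<longleftrightarrow> A \<inter> B = {} \<and> A \<inter> C = {} \<and> B \<inter> C = {}"

text \<open>\<open>Ind A B C\<close> stands for the conditional independence of \<open>A\<close> and \<open>B\<close> given \<open>C\<close>.\<close>

definition causal_markov ::
    "'v set \<Rightarrow> 'v rel \<Rightarrow> ('v set \<Rightarrow> 'v set \<Rightarrow> 'v set \<Rightarrow> bool) \<Rightarrow> bool" where
  "causal_markov V E Ind \<longleftrightarrow>
     (\<forall>A B C. A \<subseteq> V \<and> B \<subseteq> V \<and> C \<subseteq> V \<and> pairwise_disjoint A B C \<longrightarrow>
        d_separated E A B C \<longrightarrow> Ind A B C)"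

definition faithful ::
    "'v set \<Rightarrow> 'v rel \<Rightarrow> ('v set \<Rightarrow> 'v set \<Rightarrow> 'v set \<Rightarrow> bool) \<Rightarrow> bool" where
  "faithful V E Ind \<longleftrightarrow>
     (\<forall>A B C. A \<subseteq> V \<and> B \<subseteq> V \<and> C \<subseteq> V \<and> pairwise_disjoint A B C \<longrightarrow>
        Ind A B C \<longrightarrow> d_separated E A B C)"


section \<open>Conditional independence\<close>

definition cond_indep :: "'w measure \<Rightarrow> 'w measure \<Rightarrow> 'w measure \<Rightarrow> 'w measure \<Rightarrow> bool" where
  "cond_indep P F G H \<longleftrightarrow>
     (\<forall>A\<in>sets F. \<forall>B\<in>sets G. AE \<omega> in P.
        real_cond_exp P H (indicator (A \<inter> B)) \<omega> =
        real_cond_exp P H (indicator A) \<omega> * real_cond_exp P H (indicator B) \<omega>)"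


section \<open>Causal graph and augmented graph\<close>

text \<open>A causal graph on \<open>{T, Y, U}\<close> is an edge relation of type \<open>variable rel\<close>.\<close>

datatype variable = Treatment | Outcome | Unobserved

definition parents :: "variable rel \<Rightarrow> variable \<Rightarrow> variable set" where
  "parents G V = {W. (W, V) \<in> G}"

definition hidden_confounding :: "variable rel \<Rightarrow> bool" where
  "hidden_confounding G \<longleftrightarrow> (Unobserved, Treatment) \<in> G \<and> (Unobserved, Outcome) \<in> G"

text \<open>\<open>Mech V k\<close> is the vertex \<open>\<Theta>\<^sub>V\<close> of environment \<open>k\<close>;
  \<open>Obs V k i\<close> is the \<open>i\<close>-th observation of \<open>V\<close> in environment \<open>k\<close>.\<close>

datatype vertex = Mech variable nat | Obs variable nat nat

definition aug_vertices :: "nat \<Rightarrow> (nat \<Rightarrow> nat) \<Rightarrow> vertex set" where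
  "aug_vertices K N = {Mech V k |V k. k \<in> {1..K}} \<union>
     {Obs V k i |V k i. k \<in> {1..K} \<and> i \<in> {1..N k}}"

definition aug_edges :: "variable rel \<Rightarrow> nat \<Rightarrow> (nat \<Rightarrow> nat) \<Rightarrow> vertex rel" where
  "aug_edges G K N =
     {(Obs V k i, Obs W k i) |V W k i. (V, W) \<in> G \<and> k \<in> {1..K} \<and> i \<in> {1..N k}} \<union>
     {(Mech V k, Obs V k i) |V k i. k \<in> {1..K} \<and> i \<in> {1..N k}}"


section \<open>The hierarchical multi-environment model\<close>

text \<open>
  A unit is a triple \<open>(t, y, u)\<close>. The component \<open>u\<close> ranges over a Polish space, which covers
  every finite dimension as well as countably infinite dimension. The mechanism parameters
  range over arbitrary measurable spaces.
\<close>

abbreviation unit_space :: "(real \<times> real \<times> 'u::polish_space) measure" where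
  "unit_space \<equiv> borel \<Otimes>\<^sub>M (borel \<Otimes>\<^sub>M borel)"

text \<open>
  \<open>law_T\<close>, \<open>law_Y\<close>, \<open>law_U\<close> are the distributions of \<open>\<Theta>\<^sub>T\<close>, \<open>\<Theta>\<^sub>Y\<close>, \<open>\<Theta>\<^sub>U\<close>, and \<open>law\<close> is the joint
  distribution of the triple. The joint distribution is a separate field because the three
  mechanisms are only required to be pairwise independent. A kernel takes a mechanism
  parameter and a full triple \<open>(t, y, u)\<close>, but may depend only on those components that are
  parents (see \<open>mechanism_kernel\<close>).
\<close>

record ('a, 'b, 'c, 'u) mechanisms =
  law_T :: "'a measure"
  law_Y :: "'b measure"
  law_U :: "'c measure"
  law :: "('a \<times> 'b \<times> 'c) measure"
  kernel_T :: "'a \<Rightarrow> real \<times> real \<times> 'u \<Rightarrow> real measure"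
  kernel_Y :: "'b \<Rightarrow> real \<times> real \<times> 'u \<Rightarrow> real measure"
  kernel_U :: "'c \<Rightarrow> real \<times> real \<times> 'u \<Rightarrow> 'u measure"

definition nondegenerate :: "'a measure \<Rightarrow> bool" where
  "nondegenerate Q \<longleftrightarrow> \<not> (\<exists>c\<in>space Q. Q = return Q c)"

definition pairwise_independent_mechanisms :: "('a, 'b, 'c, 'u) mechanisms \<Rightarrow> bool" where
  "pairwise_independent_mechanisms m \<longleftrightarrow>
     (let \<sigma>T = sets (vimage_algebra (space (law m)) (\<lambda>(a, b, c). a) (law_T m));
          \<sigma>Y = sets (vimage_algebra (space (law m)) (\<lambda>(a, b, c). b) (law_Y m));
          \<sigma>U = sets (vimage_algebra (space (law m)) (\<lambda>(a, b, c). c) (law_U m))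
      in prob_space.indep_set (law m) \<sigma>T \<sigma>Y \<and>
         prob_space.indep_set (law m) \<sigma>T \<sigma>U \<and>
         prob_space.indep_set (law m) \<sigma>Y \<sigma>U)"

fun agree_on :: "variable set \<Rightarrow> real \<times> real \<times> 'u \<Rightarrow> real \<times> real \<times> 'u \<Rightarrow> bool" where
  "agree_on S (t, y, u) (t', y', u') \<longleftrightarrow>
     (Treatment \<in> S \<longrightarrow> t = t') \<and> (Outcome \<in> S \<longrightarrow> y = y') \<and> (Unobserved \<in> S \<longrightarrow> u = u')"

definition mechanism_kernel ::
    "variable set \<Rightarrow> 'p measure \<Rightarrow>
     ('p \<Rightarrow> real \<times> real \<times> 'u::polish_space \<Rightarrow> 'v::topological_space measure) \<Rightarrow> bool" where
  "mechanism_kernel Pa Q \<kappa> \<longleftrightarrow>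
     (\<lambda>(\<theta>, x). \<kappa> \<theta> x) \<in> Q \<Otimes>\<^sub>M unit_space \<rightarrow>\<^sub>M prob_algebra borel \<and>
     (\<forall>\<theta>\<in>space Q. \<forall>x x'. agree_on Pa x x' \<longrightarrow> \<kappa> \<theta> x = \<kappa> \<theta> x')"

definition hierarchical_model ::
    "variable rel \<Rightarrow> ('a, 'b, 'c, 'u::polish_space) mechanisms \<Rightarrow> bool" where
  "hierarchical_model G m \<longleftrightarrow>
     prob_space (law m) \<and>
     sets (law m) = sets (law_T m \<Otimes>\<^sub>M (law_Y m \<Otimes>\<^sub>M law_U m)) \<and>
     distr (law m) (law_T m) (\<lambda>(a, b, c). a) = law_T m \<and>
     distr (law m) (law_Y m) (\<lambda>(a, b, c). b) = law_Y m \<and>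
     distr (law m) (law_U m) (\<lambda>(a, b, c). c) = law_U m \<and>
     nondegenerate (law_T m) \<and> nondegenerate (law_Y m) \<and> nondegenerate (law_U m) \<and>
     pairwise_independent_mechanisms m \<and>
     mechanism_kernel (parents G Treatment) (law_T m) (kernel_T m) \<and>
     mechanism_kernel (parents G Outcome) (law_Y m) (kernel_Y m) \<and>
     mechanism_kernel (parents G Unobserved) (law_U m) (kernel_U m)"

definition topological_order :: "variable rel \<Rightarrow> variable list \<Rightarrow> bool" where
  "topological_order G Vs \<longleftrightarrow> distinct Vs \<and> set Vs = UNIV \<and>
     (\<forall>i j. i < length Vs \<and> j < length Vs \<and> (Vs ! i, Vs ! j) \<in> G \<longrightarrow> i < j)"

text \<open>Redraw the component \<open>V\<close> of a triple from its mechanism and keep the other two.\<close>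

fun draw :: "('a, 'b, 'c, 'u::polish_space) mechanisms \<Rightarrow> 'a \<times> 'b \<times> 'c \<Rightarrow> variable \<Rightarrow>
    real \<times> real \<times> 'u \<Rightarrow> (real \<times> real \<times> 'u) measure" where
  "draw m (a, b, c) Treatment (t, y, u) = distr (kernel_T m a (t, y, u)) unit_space (\<lambda>t'. (t', y, u))"
| "draw m (a, b, c) Outcome (t, y, u) = distr (kernel_Y m b (t, y, u)) unit_space (\<lambda>y'. (t, y', u))"
| "draw m (a, b, c) Unobserved (t, y, u) = distr (kernel_U m c (t, y, u)) unit_space (\<lambda>u'. (t, y, u'))"

text \<open>
  The distribution of one unit with causal factorization \<open>\<Prod>\<^sub>V P\<^sub>\<theta>(V | Pa(V))\<close>: draw the three
  components one after the other along a topological order of \<open>G\<close>. Neither the start value nor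
  the choice of the topological order matters: every component is overwritten
  exactly once, after its parents, and its kernel depends on its parents only.
\<close>

definition unit_law :: "variable rel \<Rightarrow> ('a, 'b, 'c, 'u::polish_space) mechanisms \<Rightarrow>
    'a \<times> 'b \<times> 'c \<Rightarrow> (real \<times> real \<times> 'u) measure" where
  "unit_law G m \<theta> =
     foldl (\<lambda>\<mu> V. \<mu> \<bind> draw m \<theta> V) (return unit_space undefined)
       (SOME Vs. topological_order G Vs)"

text \<open>
  The joint distribution \<open>P\<close> of all mechanisms (indexed by \<open>k\<close>) and all units (indexed by
  \<open>(k, i)\<close>): the mechanism triples are i.i.d. over \<open>k\<close>, and given all of them the units are
  independent with law \<open>unit_law G m (\<theta> k)\<close>.
\<close>

definition joint_law :: "variable rel \<Rightarrow> nat \<Rightarrow> (nat \<Rightarrow> nat) \<Rightarrow>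
    ('a, 'b, 'c, 'u::polish_space) mechanisms \<Rightarrow>
    ((nat \<Rightarrow> 'a \<times> 'b \<times> 'c) \<times> (nat \<times> nat \<Rightarrow> real \<times> real \<times> 'u)) measure" where
  "joint_law G K N m =
     (let Ms = PiM {1..K} (\<lambda>_. law m); I = (SIGMA k:{1..K}. {1..N k}) in
      Ms \<bind> (\<lambda>\<theta>. distr (PiM I (\<lambda>(k, i). unit_law G m (\<theta> k)))
                     (Ms \<Otimes>\<^sub>M PiM I (\<lambda>_. unit_space)) (\<lambda>x. (\<theta>, x))))"

text \<open>
  The \<open>\<sigma>\<close>-algebra generated by the random variable at a vertex (a coordinate of \<open>P\<close>), and by
  the random variables at a set of vertices. Working with \<open>\<sigma>\<close>-algebras avoids
  a common value type for the different kinds of vertices; the independence of the random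
  variables themselves is that of the \<open>\<sigma>\<close>-algebras they generate.
\<close>

fun vertex_algebra :: "('a, 'b, 'c, 'u::polish_space) mechanisms \<Rightarrow>
    ((nat \<Rightarrow> 'a \<times> 'b \<times> 'c) \<times> (nat \<times> nat \<Rightarrow> real \<times> real \<times> 'u)) measure \<Rightarrow> vertex \<Rightarrow>
    ((nat \<Rightarrow> 'a \<times> 'b \<times> 'c) \<times> (nat \<times> nat \<Rightarrow> real \<times> real \<times> 'u)) measure" where
  "vertex_algebra m P (Mech Treatment k) =
     vimage_algebra (space P) (\<lambda>(\<theta>, x). case \<theta> k of (a, b, c) \<Rightarrow> a) (law_T m)"
| "vertex_algebra m P (Mech Outcome k) =
     vimage_algebra (space P) (\<lambda>(\<theta>, x). case \<theta> k of (a, b, c) \<Rightarrow> b) (law_Y m)"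
| "vertex_algebra m P (Mech Unobserved k) =
     vimage_algebra (space P) (\<lambda>(\<theta>, x). case \<theta> k of (a, b, c) \<Rightarrow> c) (law_U m)"
| "vertex_algebra m P (Obs Treatment k i) =
     vimage_algebra (space P) (\<lambda>(\<theta>, x). case x (k, i) of (t, y, u) \<Rightarrow> t) borel"
| "vertex_algebra m P (Obs Outcome k i) =
     vimage_algebra (space P) (\<lambda>(\<theta>, x). case x (k, i) of (t, y, u) \<Rightarrow> y) borel"
| "vertex_algebra m P (Obs Unobserved k i) =
     vimage_algebra (space P) (\<lambda>(\<theta>, x). case x (k, i) of (t, y, u) \<Rightarrow> u) borel"

definition generated_algebra :: "('a, 'b, 'c, 'u::polish_space) mechanisms \<Rightarrow>
    ((nat \<Rightarrow> 'a \<times> 'b \<times> 'c) \<times> (nat \<times> nat \<Rightarrow> real \<times> real \<times> 'u)) measure \<Rightarrow> vertex set \<Rightarrow>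
    ((nat \<Rightarrow> 'a \<times> 'b \<times> 'c) \<times> (nat \<times> nat \<Rightarrow> real \<times> real \<times> 'u)) measure" where
  "generated_algebra m P S = sigma (space P) (\<Union>v\<in>S. sets (vertex_algebra m P v))"

definition indep_given :: "variable rel \<Rightarrow> nat \<Rightarrow> (nat \<Rightarrow> nat) \<Rightarrow>
    ('a, 'b, 'c, 'u::polish_space) mechanisms \<Rightarrow> vertex set \<Rightarrow> vertex set \<Rightarrow> vertex set \<Rightarrow> bool" where
  "indep_given G K N m A B C \<longleftrightarrow>
     (let P = joint_law G K N m in
      cond_indep P (generated_algebra m P A) (generated_algebra m P B) (generated_algebra m P C))"

end

theory Submission
  imports Defs
begin

text \<open>
  By the Markov property and faithfulness both dependencies are statements about d-separation in
  the augmented graph; they are exchanged by swapping treatment with outcome and \<open>i\<close> with \<open>j\<close>.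

  With confounding, \<open>T\<^sub>j \<leftarrow> \<Theta>\<^sub>T \<rightarrow> T\<^sub>i \<leftarrow> U\<^sub>i \<rightarrow> Y\<^sub>i\<close> is active given \<open>T\<^sub>i\<close>, and the mirrored path is active
  given \<open>Y\<^sub>j\<close>. Without confounding, acyclicity allows us to assume that \<open>Y\<close> is not an ancestor of
  \<open>T\<close> (the other case is symmetric). An active path from \<open>T\<^sub>j\<close> given \<open>T\<^sub>i\<close> then runs through
  copies and mechanisms of ancestors of \<open>T\<close>. It can leave them only along an edge \<open>V \<rightarrow> W\<close> inside
  one unit, and that unit is not unit \<open>i\<close>: there \<open>T\<^sub>i\<close> blocks, and a proper ancestor of \<open>T\<close> has no
  child outside the ancestors of \<open>T\<close>. After that it can only follow directed edges in that
  unit, because its colliders are not ancestors of \<open>T\<^sub>i\<close>. So it never reaches \<open>Y\<^sub>i\<close>.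
\<close>

lemma undirected_path_rev:
  assumes "undirected_path E p"
  shows "undirected_path E (rev p)"
  unfolding undirected_path_def
proof (intro conjI allI impI)
  show "rev p \<noteq> []" "distinct (rev p)"
    using assms by (auto simp: undirected_path_def)
  fix i assume i: "Suc i < length (rev p)"
  define n where "n = length p - Suc (Suc i)"
  have "Suc n < length p" "rev p ! i = p ! Suc n" "rev p ! Suc i = p ! n"
    using i by (auto simp: n_def rev_nth Suc_diff_Suc)
  then show "(rev p ! i, rev p ! Suc i) \<in> E \<or> (rev p ! Suc i, rev p ! i) \<in> E"
    using assms by (auto simp: undirected_path_def)
qed

lemma blocked_rev:
  assumes "blocked E C p"
  shows "blocked E C (rev p)"
proof -
  obtain i where i: "0 < i" "Suc i < length p"
    and b: "if collider_at E p i then E\<^sup>* `` {p ! i} \<inter> C = {} else p ! i \<in> C"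
    using assms by (auto simp: blocked_def)
  define n where "n = length p - Suc i"
  have n: "0 < n" "Suc n < length (rev p)"
    using i by (auto simp: n_def)
  have nth: "rev p ! n = p ! i" "rev p ! (n - 1) = p ! Suc i" "rev p ! Suc n = p ! (i - 1)"
    using i by (auto simp: n_def rev_nth Suc_diff_Suc)
  have "collider_at E (rev p) n \<longleftrightarrow> collider_at E p i"
    unfolding collider_at_def nth by auto
  with b n nth show ?thesis
    unfolding blocked_def by metis
qed

lemma d_separated_sym:
  assumes "d_separated E A B C"
  shows "d_separated E B A C"
  unfolding d_separated_def
proof (intro allI impI)
  fix p assume p: "undirected_path E p \<and> hd p \<in> B \<and> last p \<in> A"
  then have "p \<noteq> []" by (simp add: undirected_path_def)
  with p have "undirected_path E (rev p)" "hd (rev p) \<in> A" "last (rev p) \<in> B"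
    by (simp_all add: undirected_path_rev hd_rev last_rev)
  then have "blocked E C (rev p)"
    using assms by (simp add: d_separated_def)
  then show "blocked E C p"
    using blocked_rev by fastforce
qed

lemma aug_edges_into_Mech [simp]: "(v, Mech V k) \<notin> aug_edges G K N"
  by (auto simp: aug_edges_def)

lemma aug_edges_Obs_Obs:
  "(Obs V k i, Obs W l j) \<in> aug_edges G K N \<longleftrightarrow>
     (V, W) \<in> G \<and> l = k \<and> j = i \<and> k \<in> {1..K} \<and> i \<in> {1..N k}"
  by (auto simp: aug_edges_def)

lemma aug_edges_Mech_Obs:
  "(Mech V k, Obs W l j) \<in> aug_edges G K N \<longleftrightarrow> W = V \<and> l = k \<and> k \<in> {1..K} \<and> j \<in> {1..N k}"
  by (auto simp: aug_edges_def)

lemmas aug_edges_simps = aug_edges_Obs_Obs aug_edges_Mech_Obs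

text \<open>No edge enters a mechanism and edges between observations stay in one unit, so a
  directed path cannot leave its unit.\<close>

lemma aug_edges_rtrancl_Obs:
  assumes "(Obs V k i, w) \<in> (aug_edges G K N)\<^sup>*"
  shows "\<exists>W. w = Obs W k i \<and> (V, W) \<in> G\<^sup>*"
  using assms
proof (induction rule: rtrancl_induct)
  case (step v w)
  then obtain W where "v = Obs W k i" "(V, W) \<in> G\<^sup>*" by blast
  with step.hyps(2) show ?case
    by (cases w) (auto simp: aug_edges_simps intro: rtrancl_into_rtrancl)
qed auto

text \<open>
  The second hypothesis keeps an active path from leaving the ancestors of \<open>A\<close> inside unit \<open>i\<close>,
  where \<open>A\<close> itself is observed.
\<close>

lemma d_separated_across_units:
  assumes ij: "i \<noteq> j"
    and closed: "\<And>V W. V \<noteq> A \<Longrightarrow> (V, A) \<in> G\<^sup>* \<Longrightarrow> (V, W) \<in> G \<Longrightarrow> (W, A) \<in> G\<^sup>*"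
    and nanc: "(B, A) \<notin> G\<^sup>*"
  shows "d_separated (aug_edges G K N) {Obs A k j} {Obs B k i} {Obs A k i}"
  unfolding d_separated_def
proof (intro allI impI)
  let ?E = "aug_edges G K N" and ?C = "{Obs A k i}"
  fix p assume p: "undirected_path ?E p \<and> hd p \<in> {Obs A k j} \<and> last p \<in> {Obs B k i}"
  \<comment> \<open>Invariant along the path: \<open>upper\<close> while it is among copies and
    mechanisms of ancestors of \<open>A\<close>, \<open>lower\<close> once it has left them.
    \<open>lower\<close> records the incoming edge, so that a step backwards would create a
    collider.\<close>
  define upper where "upper n \<longleftrightarrow> (\<exists>V. (V, A) \<in> G\<^sup>* \<and> (p ! n = Mech V k \<or> (\<exists>l. p ! n = Obs V k l)))"
    for n
  define lower where "lower n \<longleftrightarrow> n > 0 \<and> (p ! (n - 1), p ! n) \<in> ?E \<and>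
      (\<exists>W l. (W, A) \<notin> G\<^sup>* \<and> l \<noteq> i \<and> p ! n = Obs W k l)" for n
  show "blocked ?E ?C p"
  proof (rule ccontr)
    assume active: "\<not> blocked ?E ?C p"
    have p0: "p \<noteq> []" "p ! 0 = Obs A k j"
      using p by (auto simp: undirected_path_def hd_conv_nth)
    have "upper n \<or> lower n" if "n < length p" for n
      using that
    proof (induction n)
      case 0
      then show ?case using p0 by (auto simp: upper_def)
    next
      case (Suc n)
      then have E: "(p ! n, p ! Suc n) \<in> ?E \<or> (p ! Suc n, p ! n) \<in> ?E"
        using p by (auto simp: undirected_path_def)
      have unblocked: "if collider_at ?E p n then ?E\<^sup>* `` {p ! n} \<inter> ?C \<noteq> {} else p ! n \<notin> ?C"
        if "n > 0"
        using active that Suc.prems by (auto simp: blocked_def)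
      from Suc have "upper n \<or> lower n" by simp
      then show ?case
      proof
        assume "upper n"
        then obtain V where V: "(V, A) \<in> G\<^sup>*" and "p ! n = Mech V k \<or> (\<exists>l. p ! n = Obs V k l)"
          by (auto simp: upper_def)
        then consider (mech) "p ! n = Mech V k" | (obs) l where "p ! n = Obs V k l" by blast
        then show ?thesis
        proof cases
          case mech
          then show ?thesis
            using E V by (cases "p ! Suc n") (auto simp: upper_def aug_edges_simps)
        next
          case obs
          show ?thesis
          proof (cases "p ! Suc n")
            case (Mech W l')
            then show ?thesis
              using E V obs by (auto simp: upper_def aug_edges_simps)
          next
            case next_obs: (Obs W k' l')
            then have eq: "k' = k" "l' = l" and VW: "(V, W) \<in> G \<or> (W, V) \<in> G"
              using E obs by (auto simp: aug_edges_simps)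
            show ?thesis
            proof (cases "(W, A) \<in> G\<^sup>*")
              case True
              then show ?thesis using next_obs eq by (auto simp: upper_def)
            next
              case False
              \<comment> \<open>An edge from \<open>W\<close> to \<open>V\<close> would make
                \<open>W\<close> an ancestor of \<open>A\<close>.\<close>
              then have out: "(V, W) \<in> G" and no_back: "(W, V) \<notin> G"
                using VW V by (auto intro: converse_rtrancl_into_rtrancl)
              have "V = A" using closed V out False by blast
              \<comment> \<open>In unit \<open>i\<close> this would be the conditioning vertex:
                interior, as the path starts in unit \<open>j\<close>, and a non-collider, as the
                path leaves along an outgoing edge.\<close>
              have "l \<noteq> i"
              proof
                assume "l = i"
                then have n: "n > 0" and "p ! n \<in> ?C"
                  using p0 obs ij \<open>V = A\<close> by (auto intro: gr0I)
                moreover have "\<not> collider_at ?E p n"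
                  using obs next_obs eq no_back by (auto simp: collider_at_def aug_edges_simps)
                ultimately show False using unblocked by simp
              qed
              moreover have "(p ! n, p ! Suc n) \<in> ?E"
                using E obs next_obs eq no_back by (auto simp: aug_edges_simps)
              ultimately show ?thesis
                using False next_obs eq by (auto simp: lower_def)
            qed
          qed
        qed
      next
        assume low: "lower n"
        then obtain W l where n: "n > 0" "(p ! (n - 1), p ! n) \<in> ?E"
          and W: "(W, A) \<notin> G\<^sup>*" "l \<noteq> i" "p ! n = Obs W k l"
          by (auto simp: lower_def)
        \<comment> \<open>All descendants lie in unit \<open>l\<close>, so a collider here would
          block.\<close>
        have "?E\<^sup>* `` {p ! n} \<inter> ?C = {}"
          using W(2,3) by (auto dest: aug_edges_rtrancl_Obs)
        then have "\<not> collider_at ?E p n"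
          using unblocked n(1) by auto
        then have out: "(p ! n, p ! Suc n) \<in> ?E"
          using E n by (auto simp: collider_at_def)
        then show ?thesis
          using W by (cases "p ! Suc n")
            (auto simp: lower_def aug_edges_simps intro: converse_rtrancl_into_rtrancl)
      qed
    qed
    from this[of "length p - 1"] have "upper (length p - 1) \<or> lower (length p - 1)"
      using p0 by simp
    moreover have "p ! (length p - 1) = Obs B k i"
      using p p0 by (simp add: last_conv_nth)
    \<comment> \<open>\<open>upper\<close> fails as \<open>B\<close> is no ancestor of
      \<open>A\<close>; \<open>lower\<close> excludes unit \<open>i\<close>.\<close>
    ultimately show False
      using nanc by (auto simp: upper_def lower_def)
  qed
qed

lemma confounded_not_d_separated:
  assumes "acyclic G" and C: "(C, A) \<in> G" "(C, B) \<in> G" and AB: "A \<noteq> B"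
    and ij: "i \<noteq> j" and k: "k \<in> {1..K}" "i \<in> {1..N k}" "j \<in> {1..N k}"
  shows "\<not> d_separated (aug_edges G K N) {Obs A k j} {Obs B k i} {Obs A k i}"
proof
  let ?E = "aug_edges G K N" and ?p = "[Obs A k j, Mech A k, Obs A k i, Obs C k i, Obs B k i]"
  assume "d_separated ?E {Obs A k j} {Obs B k i} {Obs A k i}"
  \<comment> \<open>An edge from \<open>A\<close> to \<open>C\<close> would close a cycle; its
    absence keeps \<open>Obs C k i\<close> from being a collider.\<close>
  moreover have "C \<noteq> A" "C \<noteq> B" and AC: "(A, C) \<notin> G"
    using \<open>acyclic G\<close> C unfolding acyclic_def by (blast intro: trancl.intros)+
  then have "undirected_path ?E ?p"
    using C AB ij k by (auto simp: undirected_path_def aug_edges_simps less_Suc_eq)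
  ultimately have "blocked ?E {Obs A k i} ?p"
    by (auto simp: d_separated_def)
  then obtain n where n: "0 < n" "n < 4"
    and b: "if collider_at ?E ?p n then ?E\<^sup>* `` {?p ! n} \<inter> {Obs A k i} = {}
      else ?p ! n \<in> {Obs A k i}"
    by (auto simp: blocked_def)
  \<comment> \<open>The interior vertices: a mechanism without parents, the observed collider, the
    unobserved fork.\<close>
  from n consider "n = 1" | "n = 2" | "n = 3" by linarith
  then show False
  proof cases
    case 1
    then show False using b by (simp add: collider_at_def)
  next
    case 2
    then show False
      using b C k by (auto simp: collider_at_def aug_edges_simps numeral_2_eq_2)
  next
    case 3
    then show False
      using b AC \<open>C \<noteq> A\<close> by (auto simp: collider_at_def aug_edges_simps numeral_3_eq_3)
  qed
qed

text \<open>Only \<open>C\<close> can be a proper ancestor of \<open>A\<close>. It is then a parent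
  of \<open>A\<close>, hence not of \<open>B\<close>, so its children are ancestors of
  \<open>A\<close>.\<close>

lemma unconfounded_d_separated:
  assumes "acyclic G" and cover: "\<And>V. V = A \<or> V = B \<or> V = C"
    and unconfounded: "\<not> ((C, A) \<in> G \<and> (C, B) \<in> G)"
    and nanc: "(B, A) \<notin> G\<^sup>*" and ij: "i \<noteq> j"
  shows "d_separated (aug_edges G K N) {Obs A k j} {Obs B k i} {Obs A k i}"
proof (rule d_separated_across_units[OF ij _ nanc])
  fix V W assume V: "V \<noteq> A" "(V, A) \<in> G\<^sup>*" and VW: "(V, W) \<in> G"
  have VC: "V = C" using V nanc cover[of V] by blast
  \<comment> \<open>\<open>X\<close> is the first vertex after \<open>C\<close> on a directed path
    to \<open>A\<close>; only \<open>A\<close> itself remains possible.\<close>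
  obtain X where X: "(C, X) \<in> G" "(X, A) \<in> G\<^sup>*"
    using V VC by (meson converse_rtranclE)
  have "X \<noteq> B" using X nanc by blast
  moreover have "X \<noteq> C" using X \<open>acyclic G\<close> by (auto simp: acyclic_def)
  ultimately have "(C, A) \<in> G" using X cover[of X] by blast
  then have "W \<noteq> B" using unconfounded VW VC by blast
  then have "W = A \<or> W = C" using cover[of W] by blast
  then show "(W, A) \<in> G\<^sup>*" using V VC by blast
qed

theorem theorem2:
  fixes G :: "variable rel"
    and K :: nat and N :: "nat \<Rightarrow> nat"
    and m :: "('a, 'b, 'c, 'u::polish_space) mechanisms"
    and k :: nat
  assumes "acyclic G"
    and "K \<ge> 1" and "\<forall>l\<in>{1..K}. N l \<ge> 2"
    and "hierarchical_model G m"
    and "causal_markov (aug_vertices K N) (aug_edges G K N) (indep_given G K N m)"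
    and "faithful (aug_vertices K N) (aug_edges G K N) (indep_given G K N m)"
    and "k \<in> {1..K}"
  shows "hidden_confounding G \<longleftrightarrow>
    (\<forall>i\<in>{1..N k}. \<forall>j\<in>{1..N k}. i \<noteq> j \<longrightarrow>
       \<not> indep_given G K N m {Obs Treatment k j} {Obs Outcome k i} {Obs Treatment k i} \<and>
       \<not> indep_given G K N m {Obs Treatment k j} {Obs Outcome k i} {Obs Outcome k j})"
proof -
  let ?E = "aug_edges G K N"
  have indep_iff: "indep_given G K N m {Obs Treatment k j} {Obs Outcome k i} {Obs V k l} \<longleftrightarrow>
      d_separated ?E {Obs Treatment k j} {Obs Outcome k i} {Obs V k l}"
    if "i \<in> {1..N k}" "j \<in> {1..N k}" "i \<noteq> j" "V = Treatment \<and> l = i \<or> V = Outcome \<and> l = j"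
    for i j V l
  proof -
    let ?A = "{Obs Treatment k j}" and ?B = "{Obs Outcome k i}" and ?C = "{Obs V k l}"
    have "?A \<subseteq> aug_vertices K N" "?B \<subseteq> aug_vertices K N" "?C \<subseteq> aug_vertices K N"
      using that \<open>k \<in> {1..K}\<close> by (auto simp: aug_vertices_def)
    moreover have "pairwise_disjoint ?A ?B ?C"
      using that by (auto simp: pairwise_disjoint_def)
    ultimately show ?thesis
      using assms(5,6)[unfolded causal_markov_def faithful_def, rule_format, of ?A ?B ?C]
      by (intro iffI) simp_all
  qed
  show ?thesis
  proof (intro iffI ballI impI)
    fix i j assume conf: "hidden_confounding G" and ij: "i \<in> {1..N k}" "j \<in> {1..N k}" "i \<noteq> j"
    note not_sep = confounded_not_d_separated[OF \<open>acyclic G\<close> _ _ _ _ \<open>k \<in> {1..K}\<close>]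
    have "\<not> d_separated ?E {Obs Treatment k j} {Obs Outcome k i} {Obs Treatment k i}"
      using conf ij unfolding hidden_confounding_def by (intro not_sep) auto
    moreover have "\<not> d_separated ?E {Obs Outcome k i} {Obs Treatment k j} {Obs Outcome k j}"
      using conf ij unfolding hidden_confounding_def by (intro not_sep) auto
    then have "\<not> d_separated ?E {Obs Treatment k j} {Obs Outcome k i} {Obs Outcome k j}"
      using d_separated_sym by blast
    ultimately show
      "\<not> indep_given G K N m {Obs Treatment k j} {Obs Outcome k i} {Obs Treatment k i} \<and>
       \<not> indep_given G K N m {Obs Treatment k j} {Obs Outcome k i} {Obs Outcome k j}"
      using ij by (simp add: indep_iff)
  next
    assume dep: "\<forall>i\<in>{1..N k}. \<forall>j\<in>{1..N k}. i \<noteq> j \<longrightarrow>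
       \<not> indep_given G K N m {Obs Treatment k j} {Obs Outcome k i} {Obs Treatment k i} \<and>
       \<not> indep_given G K N m {Obs Treatment k j} {Obs Outcome k i} {Obs Outcome k j}"
    \<comment> \<open>Two distinct units, from \<open>N k \<ge> 2\<close>, keep \<open>dep\<close>
      from being vacuous.\<close>
    have ij: "1 \<in> {1..N k}" "2 \<in> {1..N k}" "1 \<noteq> (2::nat)"
      using bspec[OF assms(3,7)] by auto
    show "hidden_confounding G"
    proof (rule ccontr)
      assume unconf: "\<not> hidden_confounding G"
      have cover: "V = Treatment \<or> V = Outcome \<or> V = Unobserved"
        "V = Outcome \<or> V = Treatment \<or> V = Unobserved" for V
        by (cases V; simp)+
      have "(Outcome, Treatment) \<notin> G\<^sup>* \<or> (Treatment, Outcome) \<notin> G\<^sup>*"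
        using antisymD[OF acyclic_impl_antisym_rtrancl[OF \<open>acyclic G\<close>], of Treatment Outcome]
        by auto
      \<comment> \<open>The first separation holds if the outcome is no ancestor of the treatment;
        the second, with roles and units swapped, if the treatment is no ancestor of the
        outcome.\<close>
      then have
        "d_separated ?E {Obs Treatment k 2} {Obs Outcome k 1} {Obs Treatment k 1} \<or>
         d_separated ?E {Obs Treatment k 2} {Obs Outcome k 1} {Obs Outcome k 2}"
        using unconfounded_d_separated[OF \<open>acyclic G\<close> cover(1), of 1 2]
          unconfounded_d_separated[OF \<open>acyclic G\<close> cover(2), of 2 1, THEN d_separated_sym] unconf
        by (simp add: hidden_confounding_def) blast
      then show False
        using dep[rule_format, OF ij] indep_iff[OF ij(1,2)] ij(3) by simp
    qed
  qed
qed

end
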